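(* Let $u,\bar u,v,\bar v$ be the functions on $\Omega$ defined in the context. Then the matrix $$\mathsf U=\begin{pmatrix}u&-\bar v\\ v&\bar u\end{pmatrix}$$ satisfies on $\Omega$ the two-dimensional self-dual Yang–Mills-like equation $$\partial_\xi\big(\mathsf U^{-1}\partial_\eta\mathsf U\big)+\tfrac14\big[\sigma_3,\mathsf U^{-1}[\sigma_3,\mathsf U]\big]=0,$$ where $\sigma_3=\mathrm{diag}(1,-1)$ and $[X,Y]=XY-YX$.
   Context: The overbar does NOT denote complex conjugation; barred and unbarred quantities are independent. Fix $N\ge 1$ and complex constants $L_j,\bar L_j,\alpha_j,\bar\alpha_j,c_j,\bar c_j$ ($1\le j\le N$) with $L_j\ne0$, $\bar L_j\neq 0$ and $L_j\neq\bar L_k$ for all $j,k$. Put $\mathsf L=\mathrm{diag}(L_1,\dots,L_N)$, $\bar{\mathsf L}=\mathrm{diag}(\bar L_1,\dots,\bar L_N)$, columns $|\alpha\rangle=(\alpha_1,\dots,\alpha_N)^T$, $|\bar\alpha\rangle=(\bar\alpha_1,\dots,\bar\alpha_N)^T$, rows $\langle c|=(c_1,\dots,c_N)$, $\langle\bar c|=(\bar c_1,\dots,\bar c_N)$. For $(\xi,\eta)\in\mathbb C^2$ define the rows $$\langle a|=\langle c|\exp(\xi\mathsf L^{-1}-\eta\mathsf L),\qquad \langle\bar a|=\langle\bar c|\exp(-\xi\bar{\mathsf L}^{-1}+\eta\bar{\mathsf L}),$$ and the $N\times N$ matrices $$\mathsf A=\Big(\frac{\alpha_jc_k}{\bar L_j-L_k}\Big)_{j,k=1}^{N}\exp(\xi\mathsf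 L^{-1}-\eta\mathsf L),\qquad \bar{\mathsf A}=\Big(\frac{\bar\alpha_j\bar c_k}{L_j-\bar L_k}\Big)_{j,k=1}^{N}\exp(-\xi\bar{\mathsf L}^{-1}+\eta\bar{\mathsf L}),$$ which satisfy $\bar{\mathsf L}\mathsf A-\mathsf A\mathsf L=|\alpha\rangle\langle a|$ and $\mathsf L\bar{\mathsf A}-\bar{\mathsf A}\bar{\mathsf L}=|\bar\alpha\rangle\langle\bar a|$. Let $\Omega\subset\mathbb C^2$ be the open set where $\det(1+\mathsf A\bar{\mathsf A})\ne0$, and on $\Omega$ put $\mathsf G=(1+\mathsf A\bar{\mathsf A})^{-1}$, $\bar{\mathsf G}=(1+\bar{\mathsf A}\mathsf A)^{-1}$. Put $|\beta\rangle=\bar{\mathsf L}^{-1}|\alpha\rangle$, $|\bar\beta\rangle=\mathsf L^{-1}|\bar\alpha\rangle$. Define the scalar functions on $\Omega$ $$u=1-\langle\bar a|\mathsf G\mathsf A|\bar\beta\rangle,\quad v=\langle\bar a|\mathsf G|\beta\rangle,\quad \bar u=1-\langle a|\bar{\mathsf G}\bar{\mathsf A}|\beta\rangle,\quad \bar v=\langle a|\bar{\mathsf G}|\bar\beta\rangle.$$ $\partial_\xi,\partial_\eta$ are (holomorphic) partial derivatives. *)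

theory Defs
  imports "HOL-Analysis.Analysis"
begin

(* Throughout, L, Lb, \<alpha>, \<alpha>b, c, cb are the vectors of the constants; the suffix b stands for the
   overbar, which is not complex conjugation.  Rows and columns are both of type complex ^ 'n. *)

definition diag :: "complex ^ 'n \<Rightarrow> complex ^ 'n ^ 'n" where
  "diag d = (\<chi> j k. if j = k then d $ j else 0)"

(* Square matrices are not an instance of the Banach-algebra class on which exp is defined. *)
definition mat_exp :: "complex ^ 'n ^ 'n \<Rightarrow> complex ^ 'n ^ 'n" where
  "mat_exp X = (\<Sum>m. (1 / fact m) *\<^sub>R (((**) X ^^ m) (mat 1)))"

(* The bilinear pairing of a row with a column, without conjugation (unlike inner). *)
definition pairing :: "complex ^ 'n \<Rightarrow> complex ^ 'n \<Rightarrow> complex" where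
  "pairing r s = (\<Sum>j\<in>UNIV. r $ j * s $ j)"

definition expL :: "complex ^ 'n \<Rightarrow> complex \<Rightarrow> complex \<Rightarrow> complex ^ 'n ^ 'n" where
  "expL L \<xi> \<eta> = mat_exp (mat \<xi> ** matrix_inv (diag L) - mat \<eta> ** diag L)"

definition expLb :: "complex ^ 'n \<Rightarrow> complex \<Rightarrow> complex \<Rightarrow> complex ^ 'n ^ 'n" where
  "expLb Lb \<xi> \<eta> = mat_exp (mat (- \<xi>) ** matrix_inv (diag Lb) + mat \<eta> ** diag Lb)"

definition row_a :: "complex ^ 'n \<Rightarrow> complex ^ 'n \<Rightarrow> complex \<Rightarrow> complex \<Rightarrow> complex ^ 'n" where
  "row_a L c \<xi> \<eta> = c v* expL L \<xi> \<eta>"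

definition row_ab :: "complex ^ 'n \<Rightarrow> complex ^ 'n \<Rightarrow> complex \<Rightarrow> complex \<Rightarrow> complex ^ 'n" where
  "row_ab Lb cb \<xi> \<eta> = cb v* expLb Lb \<xi> \<eta>"

definition mat_A ::
  "complex ^ 'n \<Rightarrow> complex ^ 'n \<Rightarrow> complex ^ 'n \<Rightarrow> complex ^ 'n \<Rightarrow> complex \<Rightarrow> complex
    \<Rightarrow> complex ^ 'n ^ 'n" where
  "mat_A L Lb \<alpha> c \<xi> \<eta> = (\<chi> j k. \<alpha> $ j * c $ k / (Lb $ j - L $ k)) ** expL L \<xi> \<eta>"

definition mat_Ab ::
  "complex ^ 'n \<Rightarrow> complex ^ 'n \<Rightarrow> complex ^ 'n \<Rightarrow> complex ^ 'n \<Rightarrow> complex \<Rightarrow> complex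
    \<Rightarrow> complex ^ 'n ^ 'n" where
  "mat_Ab L Lb \<alpha>b cb \<xi> \<eta> = (\<chi> j k. \<alpha>b $ j * cb $ k / (L $ j - Lb $ k)) ** expLb Lb \<xi> \<eta>"

context
  fixes L Lb \<alpha> \<alpha>b c cb :: "complex ^ 'n"
begin

definition Omega :: "(complex \<times> complex) set" where
  "Omega = {(\<xi>, \<eta>). det (mat 1 + mat_A L Lb \<alpha> c \<xi> \<eta> ** mat_Ab L Lb \<alpha>b cb \<xi> \<eta>) \<noteq> 0}"

definition mat_G :: "complex \<Rightarrow> complex \<Rightarrow> complex ^ 'n ^ 'n" where
  "mat_G \<xi> \<eta> = matrix_inv (mat 1 + mat_A L Lb \<alpha> c \<xi> \<eta> ** mat_Ab L Lb \<alpha>b cb \<xi> \<eta>)"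

definition mat_Gb :: "complex \<Rightarrow> complex \<Rightarrow> complex ^ 'n ^ 'n" where
  "mat_Gb \<xi> \<eta> = matrix_inv (mat 1 + mat_Ab L Lb \<alpha>b cb \<xi> \<eta> ** mat_A L Lb \<alpha> c \<xi> \<eta>)"

definition \<beta> :: "complex ^ 'n" where
  "\<beta> = matrix_inv (diag Lb) *v \<alpha>"

definition \<beta>b :: "complex ^ 'n" where
  "\<beta>b = matrix_inv (diag L) *v \<alpha>b"

definition fun_u :: "complex \<Rightarrow> complex \<Rightarrow> complex" where
  "fun_u \<xi> \<eta> = 1 - pairing (row_ab Lb cb \<xi> \<eta>) (mat_G \<xi> \<eta> *v (mat_A L Lb \<alpha> c \<xi> \<eta> *v \<beta>b))"

definition fun_v :: "complex \<Rightarrow> complex \<Rightarrow> complex" where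
  "fun_v \<xi> \<eta> = pairing (row_ab Lb cb \<xi> \<eta>) (mat_G \<xi> \<eta> *v \<beta>)"

definition fun_ub :: "complex \<Rightarrow> complex \<Rightarrow> complex" where
  "fun_ub \<xi> \<eta> = 1 - pairing (row_a L c \<xi> \<eta>) (mat_Gb \<xi> \<eta> *v (mat_Ab L Lb \<alpha>b cb \<xi> \<eta> *v \<beta>))"

definition fun_vb :: "complex \<Rightarrow> complex \<Rightarrow> complex" where
  "fun_vb \<xi> \<eta> = pairing (row_a L c \<xi> \<eta>) (mat_Gb \<xi> \<eta> *v \<beta>b)"

definition mat_U :: "complex \<Rightarrow> complex \<Rightarrow> complex ^ 2 ^ 2" where
  "mat_U \<xi> \<eta> = vector [vector [fun_u \<xi> \<eta>, - fun_vb \<xi> \<eta>],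
                       vector [fun_v \<xi> \<eta>, fun_ub \<xi> \<eta>]]"

end

definition sigma3 :: "complex ^ 2 ^ 2" where
  "sigma3 = vector [vector [1, 0], vector [0, -1]]"

definition commutator :: "complex ^ 'n ^ 'n \<Rightarrow> complex ^ 'n ^ 'n \<Rightarrow> complex ^ 'n ^ 'n" where
  "commutator X Y = X ** Y - Y ** X"

(* deriv is an arbitrary value where the derivative does not exist, so every use of mat_deriv
   is to be accompanied by mat_differentiable. *)
definition mat_deriv :: "(complex \<Rightarrow> complex ^ 'n ^ 'm) \<Rightarrow> complex \<Rightarrow> complex ^ 'n ^ 'm" where
  "mat_deriv F z = (\<chi> j k. deriv (\<lambda>w. F w $ j $ k) z)"

definition mat_differentiable :: "(complex \<Rightarrow> complex ^ 'n ^ 'm) \<Rightarrow> complex \<Rightarrow> bool" where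
  "mat_differentiable F z \<longleftrightarrow> (\<forall>j k. (\<lambda>w. F w $ j $ k) field_differentiable at z)"

definition d_xi ::
  "(complex \<Rightarrow> complex \<Rightarrow> complex ^ 'n ^ 'm) \<Rightarrow> complex \<Rightarrow> complex \<Rightarrow> complex ^ 'n ^ 'm" where
  "d_xi F \<xi> \<eta> = mat_deriv (\<lambda>x. F x \<eta>) \<xi>"

definition d_eta ::
  "(complex \<Rightarrow> complex \<Rightarrow> complex ^ 'n ^ 'm) \<Rightarrow> complex \<Rightarrow> complex \<Rightarrow> complex ^ 'n ^ 'm" where
  "d_eta F \<xi> \<eta> = mat_deriv (\<lambda>y. F \<xi> y) \<eta>"

lemma diag_mult: "diag d ** diag e = diag (\<chi> j. d $ j * e $ j)"
  by (simp add: diag_def matrix_matrix_mult_def vec_eq_iff mult_delta_left)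

lemma diag_power: "((**) (diag d) ^^ m) (mat 1) = diag (\<chi> j. d $ j ^ m)"
proof (induction m)
  case 0
  show ?case by (simp add: diag_def mat_def vec_eq_iff)
next
  case (Suc m)
  then show ?case by (simp add: diag_mult)
qed

lemma mat_exp_diag: "mat_exp (diag d) = diag (\<chi> j. exp (d $ j))"
proof -
  have "(\<lambda>m. (1 / fact m) *\<^sub>R (((**) (diag d) ^^ m) (mat 1))) sums diag (\<chi> j. exp (d $ j))"
    unfolding sums_def
  proof (intro vec_tendstoI)
    fix i k
    have "(\<lambda>m. (1 / fact m) *\<^sub>R (if i = k then d $ i ^ m else 0)) sums (if i = k then exp (d $ i) else 0)"
      using exp_converges[of "d $ i"] by (cases "i = k") (simp_all add: inverse_eq_divide)
    then show "(\<lambda>n. (\<Sum>m<n. (1 / fact m) *\<^sub>R (((**) (diag d) ^^ m) (mat 1))) $ i $ k)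
        \<longlonglongrightarrow> diag (\<chi> j. exp (d $ j)) $ i $ k"
      unfolding sums_def diag_power by (cases "i = k") (simp_all add: diag_def)
  qed
  then show ?thesis unfolding mat_exp_def by (rule sums_unique[symmetric])
qed

lemma matrix_inv_diag:
  assumes "\<And>j. d $ j \<noteq> 0"
  shows "matrix_inv (diag d) = diag (\<chi> j. 1 / d $ j)"
proof -
  let ?e = "diag (\<chi> j. 1 / d $ j)"
  have de: "diag d ** ?e = mat 1" and ed: "?e ** diag d = mat 1"
    using assms by (simp_all add: diag_mult) (simp_all add: diag_def mat_def vec_eq_iff)
  have "diag d ** matrix_inv (diag d) = mat 1 \<and> matrix_inv (diag d) ** diag d = mat 1"
    unfolding matrix_inv_def by (rule someI[where x = ?e]) (simp add: de ed)
  then have "(matrix_inv (diag d) ** diag d) ** ?e = ?e" by simp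
  then show ?thesis by (simp add: de flip: matrix_mul_assoc)
qed

end

theory Submission
  imports Defs
begin

text \<open>
  Combine the data into \<open>2N \<times> 2N\<close> blocks: \<open>\<Lambda> = diag(L, Lb)\<close>, \<open>S = diag(1, -1)\<close> and
  \<open>K = ((0, Ab), (-A, 0))\<close>, and put \<open>P = (1 + K)^-1\<close>.  The two Sylvester equations become
  \<open>\<Lambda> K - K \<Lambda> = B R\<close> with \<open>R = ((0, ab), (a, 0))\<close> and \<open>B = ((\<alpha>b, 0), (0, -\<alpha>))\<close>, and \<open>S\<close>
  anticommutes with \<open>K\<close>.  The transpose of \<open>U\<close> is the gauge matrix \<open>W = 1 - R P \<Lambda>^-1 B\<close>, whose
  inverse is \<open>1 + R \<Lambda>^-1 P B\<close>.  As \<open>\<partial>\<^sub>\<xi>\<close> and \<open>\<partial>\<^sub>\<eta>\<close> multiply \<open>K\<close> and \<open>R\<close> from the right by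
  \<open>S \<Lambda>^-1\<close> and \<open>-S \<Lambda>\<close>, one finds \<open>(\<partial>\<^sub>\<eta> W) W^-1 = Q\<close> with \<open>Q = R P S P B\<close>, and
  \<open>W \<sigma>\<^sub>3 W^-1 = \<sigma>\<^sub>3 - 2 R P S \<Lambda>^-1 P B\<close>.  Finally \<open>2 P S P = S P + P S\<close> turns \<open>4 \<partial>\<^sub>\<xi> Q\<close> into
  \<open>-[W \<sigma>\<^sub>3 W^-1, \<sigma>\<^sub>3]\<close>, which is the transposed equation.
\<close>

section \<open>Matrix algebra\<close>

lemma matrix_add_rdistrib:
  fixes A B :: "'a::comm_ring_1 ^ 'n ^ 'm"
  shows "(A + B) ** C = A ** C + B ** C"
  by (simp add: matrix_matrix_mult_def vec_eq_iff ring_distribs sum.distrib)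

lemma matrix_diff_rdistrib:
  fixes A B :: "'a::comm_ring_1 ^ 'n ^ 'm"
  shows "(A - B) ** C = A ** C - B ** C"
  by (simp add: matrix_matrix_mult_def vec_eq_iff ring_distribs sum_subtractf)

lemma matrix_diff_ldistrib:
  fixes A :: "'a::comm_ring_1 ^ 'n ^ 'm"
  shows "A ** (B - C) = A ** B - A ** C"
  by (simp add: matrix_matrix_mult_def vec_eq_iff ring_distribs sum_subtractf)

lemma matrix_uminus_left:
  fixes A :: "'a::comm_ring_1 ^ 'n ^ 'm"
  shows "(- A) ** B = - (A ** B)"
  by (simp add: matrix_matrix_mult_def vec_eq_iff sum_negf)

lemma matrix_uminus_right:
  fixes A :: "'a::comm_ring_1 ^ 'n ^ 'm"
  shows "A ** (- B) = - (A ** B)"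
  by (simp add: matrix_matrix_mult_def vec_eq_iff sum_negf)

text \<open>The product of vectors is componentwise, and the simplifier collects \<open>X + X\<close> to \<open>2 * X\<close>.\<close>

lemma matrix_mult_2:
  fixes A :: "'a::comm_ring_1 ^ 'n ^ 'm"
  shows "A ** (2 * B) = 2 * (A ** B)" "(2 * A) ** C = 2 * (A ** C)"
  by (simp_all only: mult_2 matrix_add_ldistrib matrix_add_rdistrib)

lemmas matrix_ring_simps = matrix_mult_2 matrix_add_ldistrib matrix_add_rdistrib matrix_diff_ldistrib
  matrix_diff_rdistrib matrix_uminus_left matrix_uminus_right matrix_mul_assoc[symmetric]

text \<open>\<open>matrix_ring_simps\<close> nests products to the right, so a rule for
  \<open>A ** B\<close> no longer matches inside a longer product; composing it with this lemma by
  \<open>THEN\<close> gives the variant that does.\<close>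

lemma matrix_mult_cong_left:
  "A ** B = C \<Longrightarrow> A ** (B ** X) = C ** X"
  by (simp add: matrix_mul_assoc)

section \<open>Derivatives of matrix functions\<close>

lemma matrix_inv_eqI:
  fixes A :: "complex ^ 'n ^ 'n"
  assumes "A ** B = mat 1"
  shows "matrix_inv A = B"
proof -
  have BA: "B ** A = mat 1"
    using assms matrix_left_right_inverse by blast
  have "A ** matrix_inv A = mat 1 \<and> matrix_inv A ** A = mat 1"
    unfolding matrix_inv_def by (rule someI[where x = B]) (simp add: assms BA)
  then show ?thesis
    by (metis BA matrix_mul_assoc matrix_mul_lid matrix_mul_rid)
qed

lemma matrix_inv_invertible:
  fixes A :: "complex ^ 'n ^ 'n"
  assumes "invertible A"
  shows "A ** matrix_inv A = mat 1" "matrix_inv A ** A = mat 1"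
proof -
  obtain B where "A ** B = mat 1" "B ** A = mat 1"
    using assms unfolding invertible_def by blast
  then show "A ** matrix_inv A = mat 1" "matrix_inv A ** A = mat 1"
    by (simp_all add: matrix_inv_eqI)
qed

text \<open>Relational counterpart of \<open>mat_differentiable\<close> and
  \<open>mat_deriv\<close>, so that existence and value of a derivative pass through the rules
  together.\<close>

definition mat_has_deriv ::
  "(complex \<Rightarrow> complex ^ 'n ^ 'm) \<Rightarrow> complex ^ 'n ^ 'm \<Rightarrow> complex \<Rightarrow> bool" where
  "mat_has_deriv F D z \<longleftrightarrow>
    (\<forall>i j. ((\<lambda>w. F w $ i $ j) has_field_derivative D $ i $ j) (at z))"

lemma mat_has_deriv_imp:
  assumes "mat_has_deriv F D z"
  shows "mat_differentiable F z" "mat_deriv F z = D"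
  using assms
  by (auto simp: mat_has_deriv_def mat_differentiable_def mat_deriv_def vec_eq_iff
      field_differentiable_def intro: DERIV_imp_deriv)

lemma mat_differentiable_imp_has_deriv:
  assumes "mat_differentiable F z"
  shows "mat_has_deriv F (mat_deriv F z) z"
  using assms
  by (simp add: mat_has_deriv_def mat_differentiable_def mat_deriv_def
      field_differentiable_derivI)

lemma mat_has_deriv_unique:
  assumes "mat_has_deriv F D z" "mat_has_deriv F D' z"
  shows "D = D'"
  using assms[THEN mat_has_deriv_imp(2)] by simp

lemma mat_has_deriv_const: "mat_has_deriv (\<lambda>w. A) 0 z"
  by (simp add: mat_has_deriv_def)

lemma mat_has_deriv_add:
  assumes "mat_has_deriv F D z" "mat_has_deriv G E z"
  shows "mat_has_deriv (\<lambda>w. F w + G w) (D + E) z"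
  using assms by (auto simp: mat_has_deriv_def intro: DERIV_add)

lemma mat_has_deriv_diff:
  assumes "mat_has_deriv F D z" "mat_has_deriv G E z"
  shows "mat_has_deriv (\<lambda>w. F w - G w) (D - E) z"
  using assms by (auto simp: mat_has_deriv_def intro: DERIV_diff)

lemma mat_has_deriv_mult:
  assumes "mat_has_deriv F D z" "mat_has_deriv G E z"
  shows "mat_has_deriv (\<lambda>w. F w ** G w) (D ** G z + F z ** E) z"
proof -
  have "((\<lambda>w. \<Sum>k\<in>UNIV. F w $ i $ k * G w $ k $ j) has_field_derivative
      (\<Sum>k\<in>UNIV. D $ i $ k * G z $ k $ j + E $ k $ j * F z $ i $ k)) (at z)" for i j
    using assms unfolding mat_has_deriv_def
    by (intro DERIV_sum DERIV_mult) auto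
  then show ?thesis
    by (simp add: mat_has_deriv_def matrix_matrix_mult_def sum.distrib mult.commute)
qed

lemma
  shows mat_differentiable_const: "mat_differentiable (\<lambda>w. A) z"
    and mat_differentiable_add: "mat_differentiable F z \<Longrightarrow> mat_differentiable G z
      \<Longrightarrow> mat_differentiable (\<lambda>w. F w + G w) z"
    and mat_differentiable_mult: "mat_differentiable F' z \<Longrightarrow> mat_differentiable G' z
      \<Longrightarrow> mat_differentiable (\<lambda>w. F' w ** G' w) z"
  by (auto intro: mat_has_deriv_imp(1) mat_has_deriv_const mat_has_deriv_add mat_has_deriv_mult
      dest!: mat_differentiable_imp_has_deriv)

lemma mat_has_deriv_transpose:
  assumes "mat_has_deriv F D z"
  shows "mat_has_deriv (\<lambda>w. transpose (F w)) (transpose D) z"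
  using assms by (simp add: mat_has_deriv_def transpose_def)

lemma mat_has_deriv_cong:
  assumes "\<forall>\<^sub>F w in nhds z. F w = G w" "mat_has_deriv G D z"
  shows "mat_has_deriv F D z"
  unfolding mat_has_deriv_def
proof (intro allI)
  fix i j
  have "\<forall>\<^sub>F w in nhds z. F w $ i $ j = G w $ i $ j"
    using assms(1) by (rule eventually_mono) simp
  from DERIV_cong_ev[OF refl this refl]
  show "((\<lambda>w. F w $ i $ j) has_field_derivative D $ i $ j) (at z)"
    using assms(2) by (simp add: mat_has_deriv_def)
qed

section \<open>Determinants and inverses of differentiable matrix functions\<close>

lemma field_differentiable_prod:
  fixes f :: "'i \<Rightarrow> complex \<Rightarrow> complex"
  assumes "\<And>i. i \<in> I \<Longrightarrow> f i field_differentiable at z"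
  shows "(\<lambda>w. \<Prod>i\<in>I. f i w) field_differentiable at z"
  using assms
  by (induction I rule: infinite_finite_induct) (auto intro: field_differentiable_mult)

lemma field_differentiable_det:
  assumes "mat_differentiable F z"
  shows "(\<lambda>w. det (F w)) field_differentiable at z"
  using assms unfolding det_def mat_differentiable_def
  by (intro field_differentiable_sum field_differentiable_mult field_differentiable_const
      field_differentiable_prod) simp

lemma eventually_det_nonzero:
  assumes "mat_differentiable F z" "det (F z) \<noteq> 0"
  shows "\<forall>\<^sub>F w in nhds z. det (F w) \<noteq> 0"
proof -
  have "isCont (\<lambda>w. det (F w)) z"
    using assms(1) by (intro field_differentiable_imp_continuous_at field_differentiable_det)
  then have "((\<lambda>w. det (F w)) \<longlongrightarrow> det (F z)) (nhds z)"
    by (simp add: isCont_def tendsto_nhds_iff)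
  then show ?thesis
    using assms(2) by (rule tendsto_imp_eventually_ne)
qed

text \<open>Cramer's rule gives the differentiability of the inverse; its derivative is then read off from
  the product rule.\<close>

lemma mat_has_deriv_inv:
  fixes F :: "complex \<Rightarrow> complex ^ 'n ^ 'n"
  assumes F: "mat_has_deriv F D z" and inv: "invertible (F z)"
  shows "mat_has_deriv (\<lambda>w. matrix_inv (F w)) (- (matrix_inv (F z) ** D ** matrix_inv (F z))) z"
proof -
  let ?G = "\<lambda>w. matrix_inv (F w)"
  have Fdiff: "mat_differentiable F z"
    using F by (rule mat_has_deriv_imp)
  have det0: "det (F z) \<noteq> 0"
    using inv invertible_det_nz by blast
  have ev: "\<forall>\<^sub>F w in nhds z. det (F w) \<noteq> 0"
    using Fdiff det0 by (rule eventually_det_nonzero)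
  \<comment> \<open>The k-th column of \<open>F w\<close> is replaced by the l-th unit vector, as
    Cramer's rule requires for the l-th column of the inverse.\<close>
  let ?N = "\<lambda>w k l. \<chi> i j. if j = k then axis l 1 $ i else F w $ i $ j"
  let ?H = "\<lambda>w. \<chi> k l. det (?N w k l) / det (F w)"
  have GH: "?G w = ?H w" if "det (F w) \<noteq> 0" for w
  proof -
    have "column l (?G w) = (\<chi> k. det (?N w k l) / det (F w))" for l
    proof (subst cramer[OF that, symmetric])
      have "F w *v column l (?G w) = column l (F w ** ?G w)"
        by (simp add: column_def matrix_matrix_mult_def matrix_vector_mult_def)
      also have "\<dots> = axis l 1"
        using that matrix_inv_invertible(1)[of "F w"]
        by (simp add: invertible_det_nz column_def mat_def axis_def vec_eq_iff)
      finally show "F w *v column l (?G w) = axis l 1" .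
    qed
    then show ?thesis
      by (simp add: column_def vec_eq_iff)
  qed
  have N: "mat_differentiable (\<lambda>w. ?N w k l) z" for k l
    unfolding mat_differentiable_def
  proof (intro allI)
    show "(\<lambda>w. ?N w k l $ i $ j) field_differentiable at z" for i j
      using Fdiff by (cases "j = k") (simp_all add: mat_differentiable_def)
  qed
  have "mat_differentiable ?H z"
    unfolding mat_differentiable_def
    using field_differentiable_divide[OF field_differentiable_det[OF N]
        field_differentiable_det[OF Fdiff] det0]
    by simp
  then have H: "mat_has_deriv ?H (mat_deriv ?H z) z"
    by (rule mat_differentiable_imp_has_deriv)
  have "\<forall>\<^sub>F w in nhds z. ?G w = ?H w"
    using ev by (rule eventually_mono) (rule GH)
  then have "mat_has_deriv ?G (mat_deriv ?H z) z"
    using H by (rule mat_has_deriv_cong)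
  then obtain E where E: "mat_has_deriv ?G E z" ..
  have "mat_has_deriv (\<lambda>w. F w ** ?G w) (D ** ?G z + F z ** E) z"
    using F E by (rule mat_has_deriv_mult)
  \<comment> \<open>At singular matrices \<open>matrix_inv\<close> is an arbitrary value, so the
    product is known to be \<open>mat 1\<close> only near \<open>z\<close>.\<close>
  moreover have "\<forall>\<^sub>F w in nhds z. F w ** ?G w = mat 1"
    using ev by (rule eventually_mono) (simp add: matrix_inv_invertible invertible_det_nz)
  then have "mat_has_deriv (\<lambda>w. F w ** ?G w) 0 z"
    using mat_has_deriv_const by (rule mat_has_deriv_cong)
  ultimately have "D ** ?G z + F z ** E = 0"
    by (rule mat_has_deriv_unique)
  then have "F z ** E = - (D ** ?G z)"
    by (simp add: eq_neg_iff_add_eq_0 add.commute)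
  from arg_cong[OF this, of "\<lambda>X. ?G z ** X"] have "E = - (?G z ** D ** ?G z)"
    using matrix_inv_invertible(2)[OF inv]
    by (simp add: matrix_mul_assoc matrix_uminus_right)
  then show ?thesis
    using E by simp
qed

section \<open>Dressing\<close>

text \<open>The three expressions take \<open>P\<close> and \<open>R\<close> as arguments because
  the algebra is done at one point, whereas differentiation lets \<open>P\<close> and
  \<open>R\<close> vary.\<close>

definition gauge where
  "gauge \<Lambda>i P R B = mat 1 - R ** P ** \<Lambda>i ** B"

definition gauge_inv where
  "gauge_inv \<Lambda>i P R B = mat 1 + R ** \<Lambda>i ** P ** B"

definition gauge_potential where
  "gauge_potential S P R B = R ** P ** S ** P ** B"

text \<open>The algebra at a single point. \<open>PK\<close> and \<open>KP\<close> encode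
  \<open>P = (1 + K)^-1\<close>; \<open>'m\<close> indexes the large block matrices,
  \<open>'p\<close> the 2 x 2 ones.\<close>

locale dressing =
  fixes \<Lambda> \<Lambda>i S K P :: "complex ^ 'm ^ 'm"
    and R :: "complex ^ 'm ^ 'p" and B :: "complex ^ 'p ^ 'm" and \<sigma> :: "complex ^ 'p ^ 'p"
  assumes PK: "P ** K = mat 1 - P" and KP: "K ** P = mat 1 - P"
    and \<Lambda>\<Lambda>i: "\<Lambda> ** \<Lambda>i = mat 1" and \<Lambda>i\<Lambda>: "\<Lambda>i ** \<Lambda> = mat 1"
    and SS: "S ** S = mat 1" and S\<Lambda>i: "\<Lambda>i ** S = S ** \<Lambda>i"
    and KS: "K ** S = - (S ** K)"
    and BR: "B ** R = \<Lambda> ** K - K ** \<Lambda>"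
    and B\<sigma>: "B ** \<sigma> = S ** B" and \<sigma>R: "\<sigma> ** R = - (R ** S)"
begin

lemmas cancel =
  PK KP \<Lambda>\<Lambda>i \<Lambda>i\<Lambda> SS
  PK[THEN matrix_mult_cong_left] KP[THEN matrix_mult_cong_left]
  \<Lambda>\<Lambda>i[THEN matrix_mult_cong_left] \<Lambda>i\<Lambda>[THEN matrix_mult_cong_left]
  SS[THEN matrix_mult_cong_left]

abbreviation W where "W \<equiv> gauge \<Lambda>i P R B"

abbreviation Wi where "Wi \<equiv> gauge_inv \<Lambda>i P R B"

abbreviation Q where "Q \<equiv> gauge_potential S P R B"

text \<open>By \<open>BR\<close>, \<open>\<Lambda>i ** B ** R ** \<Lambda>i\<close> equals
  \<open>K ** \<Lambda>i - \<Lambda>i ** K\<close>. Between two factors \<open>P\<close> this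
  becomes \<open>\<Lambda>i ** P - P ** \<Lambda>i\<close>, so the quadratic term cancels the two
  linear ones.\<close>

lemma W_Wi: "W ** Wi = mat 1"
  by (simp add: gauge_def gauge_inv_def matrix_ring_simps cancel BR[THEN matrix_mult_cong_left])

text \<open>This is \<open>BR\<close> multiplied by \<open>P\<close> on both sides, with
  \<open>K\<close> eliminated.\<close>

lemma \<Lambda>P: "\<Lambda> ** P = P ** \<Lambda> - P ** B ** R ** P"
  by (simp add: matrix_ring_simps cancel BR[THEN matrix_mult_cong_left])

text \<open>The left side is what the product rule yields for the \<eta>-derivative of
  \<open>W\<close>. Moving \<open>\<Lambda>\<close> past \<open>P\<close> lets it meet
  \<open>\<Lambda>i\<close> and splits off the factor \<open>Q\<close>.\<close>

lemma Q_W: "R ** P ** S ** \<Lambda> ** P ** \<Lambda>i ** B = Q ** W"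
  by (simp add: gauge_potential_def gauge_def matrix_ring_simps cancel \<Lambda>P[THEN matrix_mult_cong_left])

lemma PSP: "P ** S ** P + P ** S ** P = S ** P + P ** S"
proof -
  have "P ** (K ** S + S ** K) ** P = 0"
    by (simp add: KS)
  then show ?thesis
    by (simp add: matrix_ring_simps cancel algebra_simps)
qed

lemma W_\<sigma>_Wi:
  "W ** \<sigma> ** Wi = \<sigma> - (R ** P ** S ** \<Lambda>i ** P ** B + R ** P ** S ** \<Lambda>i ** P ** B)"
proof -
  have KSi: "K ** (S ** X) = - (S ** (K ** X))" for X :: "complex ^ 'p ^ 'm"
    using KS[THEN matrix_mult_cong_left, of X] by (simp add: matrix_ring_simps)
  \<comment> \<open>In the term quadratic in \<open>R\<close>, \<open>S\<close> separates
    \<open>P\<close> from \<open>K\<close>; anticommuting brings \<open>K\<close> next to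
    \<open>P\<close>, where it can be eliminated.\<close>
  have "P ** (S ** (K ** X)) = - ((mat 1 - P) ** (S ** X))" for X :: "complex ^ 'p ^ 'm"
    by (simp add: PK[THEN matrix_mult_cong_left] KSi flip: PK matrix_mul_assoc)
       (simp add: matrix_ring_simps)
  then show ?thesis
    by (simp add: gauge_def gauge_inv_def matrix_ring_simps cancel B\<sigma> \<sigma>R[THEN matrix_mult_cong_left]
        B\<sigma>[THEN matrix_mult_cong_left] BR[THEN matrix_mult_cong_left]
        S\<Lambda>i S\<Lambda>i[THEN matrix_mult_cong_left])
qed

text \<open>\<open>P'\<close> and \<open>R'\<close> are the \<xi>-derivatives of \<open>P\<close>
  and \<open>R\<close> when \<open>K\<close> and \<open>R\<close> are multiplied from the right by
  \<open>S ** \<Lambda>i\<close>, and \<open>Q'\<close> is the product rule; the rest is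
  algebra.\<close>

lemma Q_deriv:
  fixes P' R'
  assumes P': "P' = - (P ** K ** S ** \<Lambda>i ** P)" and R': "R' = R ** S ** \<Lambda>i"
  defines "Q' \<equiv> R' ** P ** S ** P ** B + R ** P' ** S ** P ** B + R ** P ** S ** P' ** B"
  shows "4 *\<^sub>R Q' + commutator (W ** \<sigma> ** Wi) \<sigma> = 0"
proof -
  \<comment> \<open>The term from \<open>R'\<close> cancels against part of the one from the left
    \<open>P'\<close>.\<close>
  have 1: "Q' = R ** P ** S ** \<Lambda>i ** P ** S ** P ** B - R ** P ** \<Lambda>i ** P ** B
      + R ** P ** S ** P ** S ** \<Lambda>i ** P ** B"
    by (simp add: Q'_def P' R' matrix_ring_simps cancel)
  \<comment> \<open>\<open>PSP\<close> applies to the doubled terms of \<open>1\<close> that contain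
    three factors \<open>P\<close>; the resulting \<open>R ** P ** \<Lambda>i ** P ** B\<close> drop
    out in \<open>2\<close>.\<close>
  have a: "R ** P ** S ** \<Lambda>i ** (P ** S ** P + P ** S ** P) ** B
      = R ** P ** \<Lambda>i ** P ** B + R ** P ** S ** \<Lambda>i ** P ** S ** B"
    unfolding PSP
    by (simp add: matrix_ring_simps)
       (simp add: S\<Lambda>i[symmetric] S\<Lambda>i[symmetric, THEN matrix_mult_cong_left] cancel
          matrix_ring_simps)
  have b: "R ** (P ** S ** P + P ** S ** P) ** S ** \<Lambda>i ** P ** B
      = R ** P ** \<Lambda>i ** P ** B + R ** S ** P ** S ** \<Lambda>i ** P ** B"
    unfolding PSP
    by (simp add: matrix_ring_simps cancel)
  have 2: "Q' + Q' = R ** P ** S ** \<Lambda>i ** P ** S ** B + R ** S ** P ** S ** \<Lambda>i ** P ** B"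
    using a b unfolding 1 by (simp add: matrix_ring_simps algebra_simps)
  \<comment> \<open>\<open>\<sigma>\<close> passes \<open>B\<close> as \<open>S\<close> but passes
    \<open>R\<close> as \<open>- S\<close>, so the commutator is \<open>-2\<close> times the sum in
    \<open>2\<close>.\<close>
  have 3: "commutator (W ** \<sigma> ** Wi) \<sigma> = - ((Q' + Q') + (Q' + Q'))"
    unfolding 2 W_\<sigma>_Wi commutator_def
    by (simp add: matrix_ring_simps B\<sigma> \<sigma>R[THEN matrix_mult_cong_left])
  have "4 *\<^sub>R Q' = (Q' + Q') + (Q' + Q')"
    by (simp add: vec_eq_iff scaleR_conv_of_real)
  then show ?thesis
    unfolding 3 by simp
qed

end

section \<open>Dependence on \<xi> and \<eta> through a diagonal exponential\<close>

lemma matrix_mult_diag: "(X ** diag d) $ i $ j = X $ i $ j * d $ j"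
  by (simp add: matrix_matrix_mult_def diag_def if_distrib cong: if_cong)

lemma diag_matrix_mult: "(diag d ** X) $ i $ j = d $ i * X $ i $ j"
  by (simp add: matrix_matrix_mult_def diag_def if_distrib if_distribR cong: if_cong)

lemma diag_commute: "diag d ** diag e = diag e ** diag d"
  by (simp add: diag_mult mult.commute)

locale dressing_flow =
  fixes \<mu> s :: "complex ^ 'm" and K0 :: "complex ^ 'm ^ 'm"
    and R0 :: "complex ^ 'm ^ 'p" and B :: "complex ^ 'p ^ 'm" and \<sigma> :: "complex ^ 'p ^ 'p"
  assumes mu: "\<And>k. \<mu> $ k \<noteq> 0" and s: "\<And>k. s $ k * s $ k = 1"
    and K0s: "K0 ** diag s = - (diag s ** K0)"
    and BR0: "B ** R0 = diag \<mu> ** K0 - K0 ** diag \<mu>"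
    and B\<sigma>: "B ** \<sigma> = diag s ** B" and \<sigma>R0: "\<sigma> ** R0 = - (R0 ** diag s)"
begin

definition E where "E \<xi> \<eta> = diag (\<chi> k. exp (s $ k * (\<xi> / \<mu> $ k - \<eta> * \<mu> $ k)))"

abbreviation \<Lambda>i where "\<Lambda>i \<equiv> diag (\<chi> k. 1 / \<mu> $ k)"

abbreviation K where "K \<xi> \<eta> \<equiv> K0 ** E \<xi> \<eta>"

abbreviation R where "R \<xi> \<eta> \<equiv> R0 ** E \<xi> \<eta>"

abbreviation P where "P \<xi> \<eta> \<equiv> matrix_inv (mat 1 + K \<xi> \<eta>)"

abbreviation W where "W \<xi> \<eta> \<equiv> gauge \<Lambda>i (P \<xi> \<eta>) (R \<xi> \<eta>) B"

abbreviation Wi where "Wi \<xi> \<eta> \<equiv> gauge_inv \<Lambda>i (P \<xi> \<eta>) (R \<xi> \<eta>) B"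

abbreviation Q where "Q \<xi> \<eta> \<equiv> gauge_potential (diag s) (P \<xi> \<eta>) (R \<xi> \<eta>) B"

text \<open>\<open>E\<close> is diagonal and hence commutes with \<open>diag \<mu>\<close> and
  \<open>diag s\<close>, so the relations for \<open>K0\<close> and \<open>R0\<close> survive right
  multiplication by it.\<close>

lemma dressing:
  assumes "invertible (mat 1 + K \<xi> \<eta>)"
  shows "dressing (diag \<mu>) \<Lambda>i (diag s) (K \<xi> \<eta>) (P \<xi> \<eta>) (R \<xi> \<eta>) B \<sigma>"
proof
  show "P \<xi> \<eta> ** K \<xi> \<eta> = mat 1 - P \<xi> \<eta>" "K \<xi> \<eta> ** P \<xi> \<eta> = mat 1 - P \<xi> \<eta>"
    using matrix_inv_invertible[OF assms]
    by (simp_all add: matrix_add_ldistrib matrix_add_rdistrib eq_diff_eq add.commute)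
  show "diag \<mu> ** \<Lambda>i = mat 1" "\<Lambda>i ** diag \<mu> = mat 1"
    by (simp_all add: diag_mult) (simp_all add: mu diag_def mat_def vec_eq_iff)
  show "diag s ** diag s = mat 1"
    using s by (simp add: diag_mult) (simp add: diag_def mat_def vec_eq_iff)
  show "\<Lambda>i ** diag s = diag s ** \<Lambda>i"
    by (rule diag_commute)
  have Es: "E \<xi> \<eta> ** diag d = diag d ** E \<xi> \<eta>" for d
    unfolding E_def by (rule diag_commute)
  show "K \<xi> \<eta> ** diag s = - (diag s ** K \<xi> \<eta>)"
    by (simp add: Es K0s[THEN matrix_mult_cong_left] matrix_ring_simps)
  show "B ** R \<xi> \<eta> = diag \<mu> ** K \<xi> \<eta> - K \<xi> \<eta> ** diag \<mu>"
    by (simp add: Es BR0[THEN matrix_mult_cong_left] matrix_ring_simps)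
  show "B ** \<sigma> = diag s ** B"
    by (rule B\<sigma>)
  show "\<sigma> ** R \<xi> \<eta> = - (R \<xi> \<eta> ** diag s)"
    by (simp add: Es \<sigma>R0[THEN matrix_mult_cong_left] matrix_ring_simps)
qed

lemma E_xi: "mat_has_deriv (\<lambda>x. E x \<eta>) (E \<xi> \<eta> ** diag s ** \<Lambda>i) \<xi>"
  unfolding mat_has_deriv_def E_def diag_mult
  by (auto simp: diag_def mu intro!: derivative_eq_intros)

lemma E_eta: "mat_has_deriv (\<lambda>y. E \<xi> y) (- (E \<xi> \<eta> ** diag s ** diag \<mu>)) \<eta>"
  unfolding mat_has_deriv_def E_def diag_mult
  by (auto simp: diag_def mu intro!: derivative_eq_intros)

text \<open>Stated for a general \<open>F\<close> with derivative \<open>F z ** D\<close> in order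
  to serve both variables.\<close>

lemma P_deriv:
  assumes E': "mat_has_deriv F (F z ** D) z" and inv: "invertible (mat 1 + K0 ** F z)"
  shows "mat_has_deriv (\<lambda>w. matrix_inv (mat 1 + K0 ** F w))
    (- (matrix_inv (mat 1 + K0 ** F z) ** K0 ** F z ** D ** matrix_inv (mat 1 + K0 ** F z))) z"
  using mat_has_deriv_inv[OF mat_has_deriv_add[OF mat_has_deriv_const
      mat_has_deriv_mult[OF mat_has_deriv_const E']] inv]
  by (simp add: matrix_mul_assoc)

lemma W_eta:
  assumes inv: "invertible (mat 1 + K \<xi> \<eta>)"
  shows "mat_has_deriv (\<lambda>y. W \<xi> y) (Q \<xi> \<eta> ** W \<xi> \<eta>) \<eta>"
proof -
  interpret D: dressing "diag \<mu>" \<Lambda>i "diag s" "K \<xi> \<eta>" "P \<xi> \<eta>" "R \<xi> \<eta>" B \<sigma>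
    using inv by (rule dressing)
  let ?D = "- (diag s ** diag \<mu>)"
  have E': "mat_has_deriv (\<lambda>y. E \<xi> y) (E \<xi> \<eta> ** ?D) \<eta>"
    using E_eta by (simp add: matrix_ring_simps)
  have "mat_has_deriv (\<lambda>y. mat 1 - R \<xi> y ** P \<xi> y ** (\<Lambda>i ** B))
    (- ((R \<xi> \<eta> ** ?D ** P \<xi> \<eta> + R \<xi> \<eta> ** - (P \<xi> \<eta> ** K \<xi> \<eta> ** ?D ** P \<xi> \<eta>)) ** (\<Lambda>i ** B))) \<eta>"
    using mat_has_deriv_diff[OF mat_has_deriv_const[of "mat 1"] mat_has_deriv_mult[OF
        mat_has_deriv_mult[OF mat_has_deriv_mult[OF mat_has_deriv_const[of R0] E'] P_deriv[OF E' inv]]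
        mat_has_deriv_const[of "\<Lambda>i ** B"]]]
    by (simp add: matrix_mul_assoc)
  \<comment> \<open>The derivatives of \<open>R\<close> and \<open>P\<close> combine because
    \<open>mat 1 - P ** K = P\<close>.\<close>
  also have "- ((R \<xi> \<eta> ** ?D ** P \<xi> \<eta> + R \<xi> \<eta> ** - (P \<xi> \<eta> ** K \<xi> \<eta> ** ?D ** P \<xi> \<eta>)) ** (\<Lambda>i ** B))
      = R \<xi> \<eta> ** P \<xi> \<eta> ** diag s ** diag \<mu> ** P \<xi> \<eta> ** \<Lambda>i ** B"
    by (simp add: matrix_ring_simps
        D.PK[THEN matrix_mult_cong_left, unfolded matrix_mul_assoc[symmetric]])
  finally show ?thesis
    by (simp add: gauge_def matrix_mul_assoc D.Q_W)
qed

lemma Q_xi: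
  assumes inv: "invertible (mat 1 + K \<xi> \<eta>)"
  obtains D where "mat_has_deriv (\<lambda>x. Q x \<eta>) D \<xi>"
    and "4 *\<^sub>R D + commutator (W \<xi> \<eta> ** \<sigma> ** Wi \<xi> \<eta>) \<sigma> = 0"
proof -
  interpret D: dressing "diag \<mu>" \<Lambda>i "diag s" "K \<xi> \<eta>" "P \<xi> \<eta>" "R \<xi> \<eta>" B \<sigma>
    using inv by (rule dressing)
  have E': "mat_has_deriv (\<lambda>x. E x \<eta>) (E \<xi> \<eta> ** (diag s ** \<Lambda>i)) \<xi>"
    using E_xi by (simp add: matrix_mul_assoc)
  note P' = P_deriv[OF E' inv]
  note R' = mat_has_deriv_mult[OF mat_has_deriv_const[of R0] E']
  have "mat_has_deriv (\<lambda>x. Q x \<eta>)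
     (R \<xi> \<eta> ** diag s ** \<Lambda>i ** P \<xi> \<eta> ** diag s ** P \<xi> \<eta> ** B
      + R \<xi> \<eta> ** - (P \<xi> \<eta> ** K \<xi> \<eta> ** diag s ** \<Lambda>i ** P \<xi> \<eta>) ** diag s ** P \<xi> \<eta> ** B
      + R \<xi> \<eta> ** P \<xi> \<eta> ** diag s ** - (P \<xi> \<eta> ** K \<xi> \<eta> ** diag s ** \<Lambda>i ** P \<xi> \<eta>) ** B) \<xi>"
    using mat_has_deriv_mult[OF mat_has_deriv_mult[OF mat_has_deriv_mult[OF
        mat_has_deriv_mult[OF R' P'] mat_has_deriv_const[of "diag s"]] P'] mat_has_deriv_const[of B]]
    unfolding gauge_potential_def
    by (simp add: matrix_ring_simps)
  then show thesis
    using D.Q_deriv[OF refl refl] that by blast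
qed

end

section \<open>Block matrices\<close>

definition block_mat ::
  "'a ^ 'c ^ 'r \<Rightarrow> 'a ^ 'd ^ 'r \<Rightarrow> 'a ^ 'c ^ 's \<Rightarrow> 'a ^ 'd ^ 's \<Rightarrow> 'a ^ ('c + 'd) ^ ('r + 's)" where
  "block_mat A B C D = (\<chi> i j.
    case i of Inl i' \<Rightarrow> (case j of Inl j' \<Rightarrow> A $ i' $ j' | Inr j' \<Rightarrow> B $ i' $ j')
            | Inr i' \<Rightarrow> (case j of Inl j' \<Rightarrow> C $ i' $ j' | Inr j' \<Rightarrow> D $ i' $ j'))"

definition block_vec :: "'a ^ 'c \<Rightarrow> 'a ^ 'd \<Rightarrow> 'a ^ ('c + 'd)" where
  "block_vec x y = (\<chi> i. case i of Inl i' \<Rightarrow> x $ i' | Inr i' \<Rightarrow> y $ i')"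

lemma block_mat_nth [simp]:
  "block_mat A B C D $ Inl i $ Inl j = A $ i $ j"
  "block_mat A B C D $ Inl i $ Inr l = B $ i $ l"
  "block_mat A B C D $ Inr k $ Inl j = C $ k $ j"
  "block_mat A B C D $ Inr k $ Inr l = D $ k $ l"
  by (simp_all add: block_mat_def)

lemma block_vec_nth [simp]:
  "block_vec x y $ Inl i = x $ i" "block_vec x y $ Inr k = y $ k"
  by (simp_all add: block_vec_def)

lemma all_sum_iff: "(\<forall>i. Q i) \<longleftrightarrow> (\<forall>i. Q (Inl i)) \<and> (\<forall>i. Q (Inr i))"
  by (metis sum.exhaust)

lemma sum_UNIV_sum_type:
  fixes f :: "'a::finite + 'b::finite \<Rightarrow> 'c::comm_monoid_add"
  shows "(\<Sum>i\<in>UNIV. f i) = (\<Sum>i\<in>UNIV. f (Inl i)) + (\<Sum>i\<in>UNIV. f (Inr i))"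
  by (simp add: sum.Plus flip: UNIV_Plus_UNIV)

lemma block_mat_mult:
  fixes A :: "'a::semiring_1 ^ 'c ^ 'r"
  shows "block_mat A B C D ** block_mat A' B' C' D'
    = block_mat (A ** A' + B ** C') (A ** B' + B ** D') (C ** A' + D ** C') (C ** B' + D ** D')"
  by (simp add: vec_eq_iff all_sum_iff matrix_matrix_mult_def sum_UNIV_sum_type)

lemma block_mat_vec_mult:
  fixes A :: "'a::semiring_1 ^ 'c ^ 'r"
  shows "block_mat A B C D *v block_vec x y = block_vec (A *v x + B *v y) (C *v x + D *v y)"
  by (simp add: vec_eq_iff all_sum_iff matrix_vector_mult_def sum_UNIV_sum_type)

lemma block_mat_add:
  "block_mat A B C D + block_mat A' B' C' D' = block_mat (A + A') (B + B') (C + C') (D + D')"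
  by (simp add: vec_eq_iff all_sum_iff)

lemma mat_1_block: "mat 1 = block_mat (mat 1) 0 0 (mat 1)"
  by (simp add: vec_eq_iff all_sum_iff mat_def)

lemma diag_block_vec: "diag (block_vec x y) = block_mat (diag x) 0 0 (diag y)"
  by (simp add: vec_eq_iff all_sum_iff diag_def)

lemma pairing_block_vec: "pairing (block_vec x y) (block_vec z w) = pairing x z + pairing y w"
  by (simp add: pairing_def sum_UNIV_sum_type)

lemma pairing_simps [simp]:
  "pairing 0 x = 0" "pairing x 0 = 0" "pairing x (- y) = - pairing x y"
  by (simp_all add: pairing_def sum_negf)

lemma matrix_mult_nth_pairing: "(A ** X) $ i $ j = pairing (A $ i) (column j X)"
  by (simp add: matrix_matrix_mult_def pairing_def column_def)

lemma column_matrix_mult: "column j (A ** B) = A *v column j B"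
  by (simp add: matrix_matrix_mult_def matrix_vector_mult_def column_def)

lemma diag_mult_vector: "(diag d *v x) $ i = d $ i * x $ i"
  by (simp add: matrix_vector_mult_def diag_def if_distrib if_distribR cong: if_cong)

lemma mat_1_nth: "mat 1 $ i $ j = (if i = j then 1 else 0)"
  by (simp add: mat_def)

lemma matrix_vector_mult_uminus:
  fixes A :: "'a::comm_ring_1 ^ 'n ^ 'm"
  shows "(- A) *v x = - (A *v x)" "A *v (- x) = - (A *v x)"
  by (simp_all add: vec_eq_iff matrix_vector_mult_def sum_negf)

lemma matrix_inv_left_inverse_eqI:
  fixes A :: "complex ^ 'n ^ 'n"
  assumes "B ** A = mat 1"
  shows "invertible A" "matrix_inv A = B"
  using assms matrix_left_right_inverse matrix_inv_eqI invertible_left_inverse by blast+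

lemma block_inverse:
  fixes A :: "complex ^ 'n ^ 'm" and C :: "complex ^ 'm ^ 'n"
  assumes inv: "invertible (mat 1 + A ** C)"
  defines "G \<equiv> matrix_inv (mat 1 + A ** C)"
    and "H \<equiv> matrix_inv (mat 1 + C ** A)"
    and "M \<equiv> block_mat (mat 1) C (- A) (mat 1)"
  shows "invertible M" "matrix_inv M = block_mat H (- (H ** C)) (G ** A) G"
proof -
  have G: "G + A ** C ** G = mat 1" "G + G ** A ** C = mat 1"
    using matrix_inv_invertible[OF inv]
    by (simp_all add: G_def matrix_add_ldistrib matrix_add_rdistrib matrix_mul_assoc)
  \<comment> \<open>The right factor is the push-through (Woodbury) inverse: invertibility of
    \<open>mat 1 + A ** C\<close> carries over to \<open>mat 1 + C ** A\<close>.\<close>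
  have "(mat 1 + C ** A) ** (mat 1 - C ** G ** A) = mat 1 + C ** A - C ** (G + A ** C ** G) ** A"
    by (simp add: matrix_ring_simps algebra_simps)
  also have "\<dots> = mat 1"
    by (simp add: G)
  finally have H: "H + H ** C ** A = mat 1"
    using matrix_inv_invertible(2)[of "mat 1 + C ** A"]
    unfolding H_def by (simp add: invertible_right_inverse matrix_add_ldistrib matrix_mul_assoc) blast
  have "block_mat H (- (H ** C)) (G ** A) G ** M = mat 1"
    using G H
    by (simp add: M_def block_mat_mult mat_1_block matrix_uminus_left matrix_uminus_right
        matrix_mul_assoc add.commute)
  from matrix_inv_left_inverse_eqI[OF this]
  show "invertible M" "matrix_inv M = block_mat H (- (H ** C)) (G ** A) G" .
qed

section \<open>The soliton matrix\<close>

lemma matrix_mult_nth_2: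
  fixes A :: "'a::semiring_1 ^ 2 ^ 'm"
  shows "(A ** X) $ i $ j = A $ i $ 1 * X $ 1 $ j + A $ i $ 2 * X $ 2 $ j"
  by (simp add: matrix_matrix_mult_def sum_2)

lemma expL_diag:
  assumes "\<And>j. L $ j \<noteq> 0"
  shows "expL L \<xi> \<eta> = diag (\<chi> j. exp (\<xi> / L $ j - \<eta> * L $ j))"
proof -
  have "mat \<xi> ** matrix_inv (diag L) - mat \<eta> ** diag L = diag (\<chi> j. \<xi> / L $ j - \<eta> * L $ j)"
    using assms by (simp add: matrix_inv_diag vec_eq_iff matrix_mult_diag) (simp add: mat_def diag_def)
  then show ?thesis
    by (simp add: expL_def mat_exp_diag)
qed

lemma expLb_diag:
  assumes "\<And>j. Lb $ j \<noteq> 0"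
  shows "expLb Lb \<xi> \<eta> = diag (\<chi> j. exp (- (\<xi> / Lb $ j - \<eta> * Lb $ j)))"
proof -
  have "mat (- \<xi>) ** matrix_inv (diag Lb) + mat \<eta> ** diag Lb
      = diag (\<chi> j. - (\<xi> / Lb $ j - \<eta> * Lb $ j))"
    using assms by (simp add: matrix_inv_diag vec_eq_iff matrix_mult_diag) (simp add: mat_def diag_def)
  then show ?thesis
    by (simp add: expLb_def mat_exp_diag)
qed

text \<open>As \<open>U\<close> is the transpose of \<open>W\<close>, this turns \<open>W_Wi\<close>
  into invertibility of \<open>U\<close> and a formula for its inverse.\<close>

lemma invertible_transpose:
  fixes A :: "complex ^ 'n ^ 'n"
  assumes "A ** B = mat 1"
  shows "invertible (transpose A)" "matrix_inv (transpose A) = transpose B"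
proof -
  have "transpose B ** transpose A = mat 1"
    by (simp add: assms flip: matrix_transpose_mul)
  then show "invertible (transpose A)" "matrix_inv (transpose A) = transpose B"
    by (rule matrix_inv_left_inverse_eqI)+
qed

lemma transpose_commutator:
  fixes X Y :: "complex ^ 'n ^ 'n"
  shows "transpose (commutator X Y) = commutator (transpose Y) (transpose X)"
proof -
  have "transpose (commutator X Y) = transpose (X ** Y) - transpose (Y ** X)"
    by (simp add: commutator_def transpose_def vec_eq_iff)
  then show ?thesis
    by (simp add: commutator_def matrix_transpose_mul)
qed

lemma transpose_sigma3: "transpose sigma3 = sigma3"
  by (simp add: vec_eq_iff forall_2 transpose_def sigma3_def)

section \<open>The given data as an instance of the dressing flow\<close>

locale soliton_data =
  fixes L Lb \<alpha> \<alpha>b c cb :: "complex ^ 'n"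
  assumes L: "\<And>j. L $ j \<noteq> 0" and Lb: "\<And>j. Lb $ j \<noteq> 0" and L_Lb: "\<And>j k. L $ j \<noteq> Lb $ k"
begin

abbreviation A where "A \<equiv> mat_A L Lb \<alpha> c"
abbreviation Ab where "Ab \<equiv> mat_Ab L Lb \<alpha>b cb"
abbreviation G where "G \<equiv> mat_G L Lb \<alpha> \<alpha>b c cb"
abbreviation Gb where "Gb \<equiv> mat_Gb L Lb \<alpha> \<alpha>b c cb"
abbreviation U where "U \<equiv> mat_U L Lb \<alpha> \<alpha>b c cb"

definition \<mu> where "\<mu> = block_vec L Lb"

text \<open>Here \<open>1\<close> is the vector all of whose entries are 1.\<close>

definition s :: "complex ^ ('n + 'n)" where "s = block_vec 1 (- 1)"

definition K0 where
  "K0 = block_mat 0 (\<chi> j k. \<alpha>b $ j * cb $ k / (L $ j - Lb $ k))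
    (- (\<chi> j k. \<alpha> $ j * c $ k / (Lb $ j - L $ k))) 0"

definition R0 :: "complex ^ ('n + 'n) ^ 2" where
  "R0 = vector [block_vec 0 cb, block_vec c 0]"

text \<open>The sign of \<open>\<alpha>\<close> matches that of the lower left block of
  \<open>K0\<close>.\<close>

definition B :: "complex ^ 2 ^ ('n + 'n)" where
  "B = transpose (vector [block_vec \<alpha>b 0, block_vec 0 (- \<alpha>)])"

sublocale dressing_flow \<mu> s K0 R0 B sigma3
proof
  show "\<mu> $ k \<noteq> 0" for k
    using L Lb by (cases k) (simp_all add: \<mu>_def)
  show "s $ k * s $ k = 1" for k
    by (cases k) (simp_all add: s_def)
  show "K0 ** diag s = - (diag s ** K0)"
    by (simp add: vec_eq_iff matrix_mult_diag diag_matrix_mult all_sum_iff s_def K0_def)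
  \<comment> \<open>These are the two Sylvester equations without exponentials; \<open>L_Lb\<close>
    in both orientations clears the two kinds of denominators.\<close>
  show "B ** R0 = diag \<mu> ** K0 - K0 ** diag \<mu>"
    using L_Lb L_Lb[symmetric]
    by (simp add: vec_eq_iff matrix_mult_diag diag_matrix_mult all_sum_iff \<mu>_def K0_def
        matrix_mult_nth_2 B_def R0_def transpose_def field_simps)
  show "B ** sigma3 = diag s ** B"
    by (simp add: vec_eq_iff diag_matrix_mult all_sum_iff s_def forall_2
        matrix_mult_nth_2 B_def transpose_def sigma3_def)
  show "sigma3 ** R0 = - (R0 ** diag s)"
    by (simp add: vec_eq_iff matrix_mult_diag all_sum_iff s_def forall_2
        matrix_mult_nth_2 R0_def sigma3_def)
qed

lemma E_block: "E \<xi> \<eta> = block_mat (expL L \<xi> \<eta>) 0 0 (expLb Lb \<xi> \<eta>)"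
proof -
  have "(\<chi> k. exp (s $ k * (\<xi> / \<mu> $ k - \<eta> * \<mu> $ k)))
      = block_vec (\<chi> j. exp (\<xi> / L $ j - \<eta> * L $ j)) (\<chi> j. exp (- (\<xi> / Lb $ j - \<eta> * Lb $ j)))"
    by (simp add: vec_eq_iff all_sum_iff s_def \<mu>_def)
  then show ?thesis
    by (simp add: E_def expL_diag[OF L] expLb_diag[OF Lb] diag_block_vec)
qed

lemma K_block: "K \<xi> \<eta> = block_mat 0 (Ab \<xi> \<eta>) (- A \<xi> \<eta>) 0"
  by (simp add: K0_def E_block block_mat_mult mat_A_def mat_Ab_def matrix_uminus_left)

lemma R_rows:
  "R \<xi> \<eta> $ 1 = block_vec 0 (row_ab Lb cb \<xi> \<eta>)" "R \<xi> \<eta> $ 2 = block_vec (row_a L c \<xi> \<eta>) 0"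
  by (simp_all add: vec_eq_iff all_sum_iff R0_def E_block row_a_def row_ab_def
      matrix_matrix_mult_def vector_matrix_mult_def sum_UNIV_sum_type)

lemma B_columns:
  "column 1 (\<Lambda>i ** B) = block_vec (\<beta>b L \<alpha>b) 0"
  "column 2 (\<Lambda>i ** B) = block_vec 0 (- \<beta> Lb \<alpha>)"
  by (simp_all add: vec_eq_iff all_sum_iff column_def diag_matrix_mult \<mu>_def B_def transpose_def
      \<beta>_def \<beta>b_def matrix_inv_diag[OF L] matrix_inv_diag[OF Lb] diag_mult_vector)

lemma
  assumes "(\<xi>, \<eta>) \<in> Omega L Lb \<alpha> \<alpha>b c cb"
  shows M_invertible: "invertible (mat 1 + K \<xi> \<eta>)"
    and P_block: "P \<xi> \<eta> = block_mat (Gb \<xi> \<eta>) (- (Gb \<xi> \<eta> ** Ab \<xi> \<eta>)) (G \<xi> \<eta> ** A \<xi> \<eta>) (G \<xi> \<eta>)"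
proof -
  have "invertible (mat 1 + A \<xi> \<eta> ** Ab \<xi> \<eta>)"
    using assms by (simp add: invertible_det_nz Omega_def)
  note this[THEN block_inverse(1)] this[THEN block_inverse(2)]
  moreover have "mat 1 + K \<xi> \<eta> = block_mat (mat 1) (Ab \<xi> \<eta>) (- A \<xi> \<eta>) (mat 1)"
    by (simp add: K_block mat_1_block block_mat_add)
  ultimately show "invertible (mat 1 + K \<xi> \<eta>)"
    "P \<xi> \<eta> = block_mat (Gb \<xi> \<eta>) (- (Gb \<xi> \<eta> ** Ab \<xi> \<eta>)) (G \<xi> \<eta> ** A \<xi> \<eta>) (G \<xi> \<eta>)"
    by (simp_all add: mat_G_def mat_Gb_def)
qed

text \<open>Each row of \<open>R\<close> and each column of \<open>\<Lambda>i ** B\<close> has a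
  single nonzero block, so each entry of \<open>W\<close> involves exactly one block of
  \<open>P\<close>.\<close>

lemma U_eq_transpose_W:
  assumes "(\<xi>, \<eta>) \<in> Omega L Lb \<alpha> \<alpha>b c cb"
  shows "U \<xi> \<eta> = transpose (W \<xi> \<eta>)"
proof -
  have "W \<xi> \<eta> = mat 1 - R \<xi> \<eta> ** (P \<xi> \<eta> ** (\<Lambda>i ** B))"
    by (simp add: gauge_def matrix_mul_assoc)
  then have "W \<xi> \<eta> $ i $ j = (if i = j then 1 else 0)
      - pairing (R \<xi> \<eta> $ i) (P \<xi> \<eta> *v column j (\<Lambda>i ** B))" for i j
    by (simp add: mat_1_nth matrix_mult_nth_pairing[of "R \<xi> \<eta>"] column_matrix_mult[of _ "P \<xi> \<eta>"])
  then show ?thesis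
    by (simp add: vec_eq_iff forall_2 transpose_def R_rows B_columns P_block[OF assms]
        block_mat_vec_mult pairing_block_vec mat_U_def fun_u_def fun_v_def fun_ub_def fun_vb_def mat_1_nth
        matrix_vector_mul_assoc matrix_vector_mult_uminus)
qed

text \<open>The formulas for \<open>U\<close> in terms of \<open>W\<close> hold only on
  \<open>Omega\<close>; they can be differentiated because they persist nearby along each coordinate
  line.\<close>

lemma eventually_Omega:
  assumes "(\<xi>, \<eta>) \<in> Omega L Lb \<alpha> \<alpha>b c cb"
  shows "\<forall>\<^sub>F x in nhds \<xi>. (x, \<eta>) \<in> Omega L Lb \<alpha> \<alpha>b c cb"
    and "\<forall>\<^sub>F y in nhds \<eta>. (\<xi>, y) \<in> Omega L Lb \<alpha> \<alpha>b c cb"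
proof -
  have F: "mat_differentiable (\<lambda>w. mat 1 + A (f w) (g w) ** Ab (f w) (g w)) z"
    if E: "mat_differentiable (\<lambda>w. E (f w) (g w)) z" for f g z
  proof -
    have "mat_differentiable (\<lambda>w. expL L (f w) (g w)) z"
      "mat_differentiable (\<lambda>w. expLb Lb (f w) (g w)) z"
      \<comment> \<open>\<open>expL\<close> and \<open>expLb\<close> are the diagonal blocks of
        \<open>E\<close>.\<close>
      using E by (simp_all add: mat_differentiable_def E_block all_sum_iff)
    then show ?thesis
      unfolding mat_A_def mat_Ab_def
      by (intro mat_differentiable_add mat_differentiable_mult mat_differentiable_const)
  qed
  have "mat_differentiable (\<lambda>x. mat 1 + A x \<eta> ** Ab x \<eta>) \<xi>"
    "mat_differentiable (\<lambda>y. mat 1 + A \<xi> y ** Ab \<xi> y) \<eta>"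
    by (rule F, rule mat_has_deriv_imp(1), rule E_xi, rule F, rule mat_has_deriv_imp(1), rule E_eta)
  from this[THEN eventually_det_nonzero]
  show "\<forall>\<^sub>F x in nhds \<xi>. (x, \<eta>) \<in> Omega L Lb \<alpha> \<alpha>b c cb"
    "\<forall>\<^sub>F y in nhds \<eta>. (\<xi>, y) \<in> Omega L Lb \<alpha> \<alpha>b c cb"
    using assms by (simp_all add: Omega_def)
qed

lemma self_dual_equation:
  assumes \<Omega>: "(\<xi>, \<eta>) \<in> Omega L Lb \<alpha> \<alpha>b c cb"
  defines "V \<equiv> (\<lambda>\<xi> \<eta>. matrix_inv (U \<xi> \<eta>) ** d_eta U \<xi> \<eta>)"
  shows "invertible (U \<xi> \<eta>)" "mat_differentiable (\<lambda>y. U \<xi> y) \<eta>"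
    "mat_differentiable (\<lambda>x. V x \<eta>) \<xi>"
    "d_xi V \<xi> \<eta>
      + (1 / 4) *\<^sub>R commutator sigma3 (matrix_inv (U \<xi> \<eta>) ** commutator sigma3 (U \<xi> \<eta>)) = 0"
proof -
  have U: "invertible (U x y)" "matrix_inv (U x y) = transpose (Wi x y)"
    if "(x, y) \<in> Omega L Lb \<alpha> \<alpha>b c cb" for x y
    unfolding U_eq_transpose_W[OF that]
    using dressing.W_Wi[OF dressing[OF M_invertible[OF that]]] by (rule invertible_transpose)+
  show "invertible (U \<xi> \<eta>)"
    using \<Omega> by (rule U)
  have U': "mat_has_deriv (\<lambda>y. U x y) (transpose (Q x y ** W x y)) y"
    if "(x, y) \<in> Omega L Lb \<alpha> \<alpha>b c cb" for x y
    using eventually_mono[OF eventually_Omega(2)[OF that] U_eq_transpose_W]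
      mat_has_deriv_transpose[OF W_eta[OF M_invertible[OF that]]]
    by (rule mat_has_deriv_cong)
  from U'[OF \<Omega>] show "mat_differentiable (\<lambda>y. U \<xi> y) \<eta>"
    by (rule mat_has_deriv_imp)
  \<comment> \<open>Transposing reverses \<open>Q ** W\<close>, so the inverse of \<open>U\<close>
    cancels the transpose of \<open>W\<close> and only that of \<open>Q\<close> remains.\<close>
  have V: "V x y = transpose (Q x y)" if "(x, y) \<in> Omega L Lb \<alpha> \<alpha>b c cb" for x y
  proof -
    have "V x y = transpose (Wi x y) ** (transpose (W x y) ** transpose (Q x y))"
      by (simp add: V_def d_eta_def mat_has_deriv_imp(2)[OF U'[OF that]] U(2)[OF that]
          matrix_transpose_mul)
    also have "\<dots> = transpose (W x y ** Wi x y) ** transpose (Q x y)"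
      by (simp add: matrix_transpose_mul matrix_mul_assoc)
    finally show ?thesis
      by (simp add: dressing.W_Wi[OF dressing[OF M_invertible[OF that]]])
  qed
  obtain D where D: "mat_has_deriv (\<lambda>x. Q x \<eta>) D \<xi>"
    and eq: "4 *\<^sub>R D + commutator (W \<xi> \<eta> ** sigma3 ** Wi \<xi> \<eta>) sigma3 = 0"
    using Q_xi[OF M_invertible[OF \<Omega>]] by blast
  have V': "mat_has_deriv (\<lambda>x. V x \<eta>) (transpose D) \<xi>"
    using eventually_mono[OF eventually_Omega(1)[OF \<Omega>] V] mat_has_deriv_transpose[OF D]
    by (rule mat_has_deriv_cong)
  then show "mat_differentiable (\<lambda>x. V x \<eta>) \<xi>"
    by (rule mat_has_deriv_imp)
  have inv: "matrix_inv (U \<xi> \<eta>) ** U \<xi> \<eta> = mat 1"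
    using U(1)[OF \<Omega>] by (rule matrix_inv_invertible)
  let ?C = "commutator sigma3 (matrix_inv (U \<xi> \<eta>) ** commutator sigma3 (U \<xi> \<eta>))"
  \<comment> \<open>The inner expression is the conjugate of \<open>sigma3\<close> by
    \<open>U\<close> minus \<open>sigma3\<close> itself, and the latter commutes with
    \<open>sigma3\<close>.\<close>
  have "?C = commutator sigma3 (matrix_inv (U \<xi> \<eta>) ** sigma3 ** U \<xi> \<eta>)"
    by (simp add: commutator_def matrix_ring_simps inv[THEN matrix_mult_cong_left])
  \<comment> \<open>Transposition exchanges the two arguments of the commutator, which brings it to
    the form in \<open>eq\<close>.\<close>
  also have "\<dots> = transpose (commutator (W \<xi> \<eta> ** sigma3 ** Wi \<xi> \<eta>) sigma3)"
    by (subst U(2)[OF \<Omega>]) (simp add: U_eq_transpose_W[OF \<Omega>] transpose_commutator transpose_sigma3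
        matrix_transpose_mul matrix_mul_assoc)
  finally have C: "?C = transpose (commutator (W \<xi> \<eta> ** sigma3 ** Wi \<xi> \<eta>) sigma3)" .
  have "commutator (W \<xi> \<eta> ** sigma3 ** Wi \<xi> \<eta>) sigma3 = - (4 *\<^sub>R D)"
    using eq by (simp add: eq_neg_iff_add_eq_0 add.commute)
  then have "?C = - (4 *\<^sub>R transpose D)"
    unfolding C by (simp add: transpose_def vec_eq_iff)
  moreover have "d_xi V \<xi> \<eta> = transpose D"
    using mat_has_deriv_imp(2)[OF V'] by (simp add: d_xi_def)
  ultimately show "d_xi V \<xi> \<eta> + (1 / 4) *\<^sub>R ?C = 0"
    by simp
qed

end

theorem proposition3p4:
  fixes L Lb \<alpha> \<alpha>b c cb :: "complex ^ 'n"
  assumes "\<forall>j. L $ j \<noteq> 0"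
    and "\<forall>j. Lb $ j \<noteq> 0"
    and "\<forall>j k. L $ j \<noteq> Lb $ k"
  defines "\<Omega> \<equiv> Omega L Lb \<alpha> \<alpha>b c cb"
    and "U \<equiv> mat_U L Lb \<alpha> \<alpha>b c cb"
  defines "V \<equiv> (\<lambda>\<xi> \<eta>. matrix_inv (U \<xi> \<eta>) ** d_eta U \<xi> \<eta>)"
  shows "\<forall>(\<xi>, \<eta>) \<in> \<Omega>.
    invertible (U \<xi> \<eta>) \<and>
    mat_differentiable (\<lambda>y. U \<xi> y) \<eta> \<and>
    mat_differentiable (\<lambda>x. V x \<eta>) \<xi> \<and>
    d_xi V \<xi> \<eta>
      + (1 / 4) *\<^sub>R commutator sigma3 (matrix_inv (U \<xi> \<eta>) ** commutator sigma3 (U \<xi> \<eta>)) = 0"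
proof -
  interpret soliton_data L Lb \<alpha> \<alpha>b c cb
    using assms(1-3) by unfold_locales auto
  show ?thesis
    using self_dual_equation unfolding \<Omega>_def U_def V_def by blast
qed

end
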